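(* Let $\psi \in L^2(\mathbb{R})$ be a wavelet and let $U$ be a unitary operator on $L^2(\mathbb{R})$ such that $U^n \in \mathcal{C}_\psi(D,T)$ for all $n \in \mathbb{Z}$. Then $U^n\psi$ is a wavelet for every $n \in \mathbb{Z}$, and the wavelets $U^n \psi$, $n \in \mathbb{Z}$, are all core equivalent to one another.
   Context: A function $\psi \in L^2(\mathbb{R})$ is a wavelet if $\{2^{j/2}\psi(2^j x + n) : j,n \in \mathbb{Z}\}$ is an orthonormal basis of $L^2(\mathbb{R})$. Define unitary operators on $L^2(\mathbb{R})$ by $Df(x) = \sqrt{2}\, f(2x)$ and $Tf(x) = f(x+1)$. The local commutant at $\psi$ is $$\mathcal{C}_\psi(D,T) = \{V \in \mathcal{B}(L^2(\mathbb{R})) : V D^n T^l \psi = D^n T^l V \psi \text{ for all } n,l \in \mathbb{Z}\}.$$ The core space of a wavelet $\psi$ is $V_0^\psi = \overline{\mathrm{span}}\{D^n T^l \psi : n < 0,\ l \in \mathbb{Z}\}$. It is invariant under $T$ and $T^{-1}$, and the unitary representation $l \mapsto T^l|_{V_0^\psi}$ of $\mathbb{Z}$ is called the core representation of $\psi$. Two wavelets are core equivalent if their core representations are unitarily equivalent. *)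

theory Defs
  imports "HOL-Analysis.Analysis"
begin

section \<open>The Hilbert space of square-integrable functions on the real line\<close>

definition square_integrable :: "(real \<Rightarrow> complex) \<Rightarrow> bool" where
  "square_integrable f \<longleftrightarrow>
     f \<in> borel_measurable lebesgue \<and> integrable lebesgue (\<lambda>x. (cmod (f x))\<^sup>2)"

definition L2_rel :: "(real \<Rightarrow> complex) \<Rightarrow> (real \<Rightarrow> complex) \<Rightarrow> bool" where
  "L2_rel f g \<longleftrightarrow>
     square_integrable f \<and> square_integrable g \<and> (AE x in lebesgue. f x = g x)"

lemma square_integrable_measurable [measurable_dest]:
  "square_integrable f \<Longrightarrow> f \<in> borel_measurable lebesgue"
  by (simp add: square_integrable_def)

lemma square_integrable_zero: "square_integrable (\<lambda>x. 0)"
  by (simp add: square_integrable_def)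

lemma square_integrable_cmult:
  assumes "square_integrable f"
  shows "square_integrable (\<lambda>x. c * f x)"
  using assms unfolding square_integrable_def
  by (auto simp: norm_mult power_mult_distrib)

lemma square_integrable_add:
  assumes f: "square_integrable f" and g: "square_integrable g"
  shows "square_integrable (\<lambda>x. f x + g x)"
proof -
  note [measurable] = square_integrable_measurable[OF f] square_integrable_measurable[OF g]
  have "integrable lebesgue (\<lambda>x. 2 * (cmod (f x))\<^sup>2 + 2 * (cmod (g x))\<^sup>2)"
    using f g by (auto simp: square_integrable_def)
  then have "integrable lebesgue (\<lambda>x. (cmod (f x + g x))\<^sup>2)"
  proof (rule Bochner_Integration.integrable_bound)
    have "(cmod (f x + g x))\<^sup>2 \<le> 2 * (cmod (f x))\<^sup>2 + 2 * (cmod (g x))\<^sup>2" for x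
    proof -
      have "(cmod (f x + g x))\<^sup>2 \<le> (cmod (f x) + cmod (g x))\<^sup>2"
        by (intro power_mono norm_triangle_ineq) auto
      also have "\<dots> \<le> 2 * (cmod (f x))\<^sup>2 + 2 * (cmod (g x))\<^sup>2"
        using zero_le_power2[of "cmod (f x) - cmod (g x)"]
        by (simp add: power2_eq_square algebra_simps)
      finally show ?thesis .
    qed
    then show "AE x in lebesgue. norm ((cmod (f x + g x))\<^sup>2)
        \<le> norm (2 * (cmod (f x))\<^sup>2 + 2 * (cmod (g x))\<^sup>2)"
      by simp
  qed simp
  then show ?thesis
    by (simp add: square_integrable_def)
qed

lemma square_integrable_uminus:
  "square_integrable f \<Longrightarrow> square_integrable (\<lambda>x. - f x)"
  using square_integrable_cmult[of f "-1"] by simp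

lemma square_integrable_diff:
  "square_integrable f \<Longrightarrow> square_integrable g \<Longrightarrow> square_integrable (\<lambda>x. f x - g x)"
  using square_integrable_add[of f "\<lambda>x. - g x"] square_integrable_uminus[of g] by simp

lemma square_integrable_mult_cnj:
  assumes f: "square_integrable f" and g: "square_integrable g"
  shows "integrable lebesgue (\<lambda>x. f x * cnj (g x))"
proof -
  note [measurable] = square_integrable_measurable[OF f] square_integrable_measurable[OF g]
  have [measurable]: "(\<lambda>x. cnj (g x)) \<in> borel_measurable lebesgue"
    by (rule borel_measurable_continuous_on[OF _ square_integrable_measurable[OF g]])
       (intro continuous_intros)
  have "integrable lebesgue (\<lambda>x. (cmod (f x))\<^sup>2 + (cmod (g x))\<^sup>2)"
    using f g by (auto simp: square_integrable_def)
  then show ?thesis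
  proof (rule Bochner_Integration.integrable_bound)
    have "cmod (f x * cnj (g x)) \<le> (cmod (f x))\<^sup>2 + (cmod (g x))\<^sup>2" for x
    proof -
      have "2 * (cmod (f x) * cmod (g x)) \<le> (cmod (f x))\<^sup>2 + (cmod (g x))\<^sup>2"
        using zero_le_power2[of "cmod (f x) - cmod (g x)"]
        by (simp add: power2_eq_square algebra_simps)
      moreover have "0 \<le> cmod (f x) * cmod (g x)"
        by simp
      ultimately show ?thesis
        by (simp only: norm_mult complex_mod_cnj)
    qed
    then show "AE x in lebesgue. norm (f x * cnj (g x))
        \<le> norm ((cmod (f x))\<^sup>2 + (cmod (g x))\<^sup>2)"
      by simp
  qed measurable
qed

lemma AE_lebesgue_affine:
  fixes c t :: real
  assumes "c \<noteq> 0" and "AE x in lebesgue. P x"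
  shows "AE x in lebesgue. P (t + c * x)"
proof -
  have meas: "(\<lambda>x. t + c * x) \<in> lebesgue \<rightarrow>\<^sub>M lebesgue"
    using lebesgue_affine_measurable[where c = "\<lambda>x::real. c"] \<open>c \<noteq> 0\<close> by simp
  have "AE x in density (distr lebesgue lebesgue (\<lambda>x. t + c * x)) (\<lambda>_. ennreal \<bar>c\<bar>). P x"
    by (subst lebesgue_real_affine[OF \<open>c \<noteq> 0\<close>, of t, symmetric]) (rule assms(2))
  then have "AE x in distr lebesgue lebesgue (\<lambda>x. t + c * x). P x"
    using \<open>c \<noteq> 0\<close> by (simp add: AE_density)
  then show ?thesis
    by (rule AE_distrD[OF meas])
qed

lemma square_integrable_affine:
  fixes c t :: real
  assumes "c \<noteq> 0" and f: "square_integrable f"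
  shows "square_integrable (\<lambda>x. f (t + c * x))"
proof -
  have meas: "(\<lambda>x. t + c * x) \<in> lebesgue \<rightarrow>\<^sub>M lebesgue"
    using lebesgue_affine_measurable[where c = "\<lambda>x::real. c"] \<open>c \<noteq> 0\<close> by simp
  have "(\<lambda>x. f (t + c * x)) \<in> borel_measurable lebesgue"
    using measurable_compose[OF meas square_integrable_measurable[OF f]] .
  moreover have "integrable lebesgue (\<lambda>x. (cmod (f (t + c * x)))\<^sup>2)"
    using f lebesgue_integrable_real_affine_iff[OF \<open>c \<noteq> 0\<close>, of "\<lambda>x. (cmod (f x))\<^sup>2" t]
    by (simp add: square_integrable_def)
  ultimately show ?thesis
    by (simp add: square_integrable_def)
qed

lemma L2_rel_affine:
  fixes c t :: real
  assumes "c \<noteq> 0" and "L2_rel f g"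
  shows "L2_rel (\<lambda>x. a * f (t + c * x)) (\<lambda>x. a * g (t + c * x))"
  using assms AE_lebesgue_affine[OF \<open>c \<noteq> 0\<close>, of "\<lambda>x. f x = g x" t]
  by (auto simp: L2_rel_def intro!: square_integrable_cmult square_integrable_affine)

quotient_type L2 = "real \<Rightarrow> complex" / partial: L2_rel
proof (rule part_equivpI)
  show "\<exists>f. L2_rel f f"
    using square_integrable_zero by (auto simp: L2_rel_def)
  show "symp L2_rel"
    by (auto simp: symp_def L2_rel_def)
  show "transp L2_rel"
    by (rule transpI) (auto simp: L2_rel_def elim: AE_mp)
qed

lift_definition scaleC_L2 :: "complex \<Rightarrow> L2 \<Rightarrow> L2" is "\<lambda>c f x. c * f x"
  by (auto simp: L2_rel_def intro: square_integrable_cmult elim: AE_mp)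

lift_definition cinner_L2 :: "L2 \<Rightarrow> L2 \<Rightarrow> complex"
  is "\<lambda>f g. integral\<^sup>L lebesgue (\<lambda>x. f x * cnj (g x))"
proof -
  fix f f' g g' assume *: "L2_rel f f'" "L2_rel g g'"
  then have "AE x in lebesgue. f x * cnj (g x) = f' x * cnj (g' x)"
    by (auto simp: L2_rel_def elim!: AE_mp)
  then show "integral\<^sup>L lebesgue (\<lambda>x. f x * cnj (g x)) = integral\<^sup>L lebesgue (\<lambda>x. f' x * cnj (g' x))"
    using * by (intro integral_cong_AE)
      (auto simp: L2_rel_def intro!: borel_measurable_integrable square_integrable_mult_cnj)
qed

instantiation L2 :: real_vector
begin

lift_definition zero_L2 :: L2 is "\<lambda>x. 0"
  by (simp add: L2_rel_def square_integrable_zero)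

lift_definition plus_L2 :: "L2 \<Rightarrow> L2 \<Rightarrow> L2" is "\<lambda>f g x. f x + g x"
  by (auto simp: L2_rel_def intro: square_integrable_add elim: AE_mp)

lift_definition uminus_L2 :: "L2 \<Rightarrow> L2" is "\<lambda>f x. - f x"
  by (auto simp: L2_rel_def intro: square_integrable_uminus elim: AE_mp)

lift_definition minus_L2 :: "L2 \<Rightarrow> L2 \<Rightarrow> L2" is "\<lambda>f g x. f x - g x"
  by (auto simp: L2_rel_def intro: square_integrable_diff elim: AE_mp)

definition scaleR_L2 :: "real \<Rightarrow> L2 \<Rightarrow> L2" where
  "scaleR_L2 r f = scaleC_L2 (complex_of_real r) f"

instance
proof
  fix f g h :: L2 and r s :: real
  show "f + g + h = f + (g + h)"
    by transfer (auto simp: L2_rel_def add.assoc intro!: square_integrable_add)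
  show "f + g = g + f"
    by transfer (auto simp: L2_rel_def add.commute intro!: square_integrable_add)
  show "0 + f = f"
    by transfer (auto simp: L2_rel_def)
  show "- f + f = 0"
    by transfer (auto simp: L2_rel_def square_integrable_zero)
  show "f - g = f + - g"
    by transfer (auto simp: L2_rel_def intro!: square_integrable_diff)
  show "r *\<^sub>R (f + g) = r *\<^sub>R f + r *\<^sub>R g"
    unfolding scaleR_L2_def
    by transfer (auto simp: L2_rel_def distrib_left distrib_right
        intro!: square_integrable_add square_integrable_cmult)
  show "(r + s) *\<^sub>R f = r *\<^sub>R f + s *\<^sub>R f"
    unfolding scaleR_L2_def
    by transfer (auto simp: L2_rel_def distrib_left distrib_right
        intro!: square_integrable_add square_integrable_cmult)
  show "r *\<^sub>R s *\<^sub>R f = (r * s) *\<^sub>R f"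
    unfolding scaleR_L2_def
    by transfer (auto simp: L2_rel_def mult.assoc intro!: square_integrable_cmult)
  show "1 *\<^sub>R f = f"
    unfolding scaleR_L2_def by transfer (auto simp: L2_rel_def)
qed

end

instantiation L2 :: real_inner
begin

definition inner_L2 :: "L2 \<Rightarrow> L2 \<Rightarrow> real" where
  "inner_L2 f g = Re (cinner_L2 f g)"

definition norm_L2 :: "L2 \<Rightarrow> real" where
  "norm_L2 f = sqrt (Re (cinner_L2 f f))"

definition dist_L2 :: "L2 \<Rightarrow> L2 \<Rightarrow> real" where
  "dist_L2 f g = norm (f - g)"

definition sgn_L2 :: "L2 \<Rightarrow> L2" where
  "sgn_L2 f = f /\<^sub>R norm f"

definition uniformity_L2 :: "(L2 \<times> L2) filter" where
  "uniformity_L2 = (INF e\<in>{0<..}. principal {(f, g). dist f g < e})"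

definition open_L2 :: "L2 set \<Rightarrow> bool" where
  "open_L2 S = (\<forall>f\<in>S. \<forall>\<^sub>F (f', g) in uniformity. f' = f \<longrightarrow> g \<in> S)"

instance
proof
  fix f g h :: L2 and r :: real
  show "dist f g = norm (f - g)"
    by (rule dist_L2_def)
  show "sgn f = f /\<^sub>R norm f"
    by (rule sgn_L2_def)
  show "uniformity = (INF e\<in>{0<..}. principal {(x :: L2, y). dist x y < e})"
    by (rule uniformity_L2_def)
  show "open S \<longleftrightarrow> (\<forall>x\<in>S. \<forall>\<^sub>F (x', y) in uniformity. x' = x \<longrightarrow> y \<in> S)" for S :: "L2 set"
    by (rule open_L2_def)
  show "inner f g = inner g f"
  proof -
    have "cinner_L2 f g = cnj (cinner_L2 g f)"
      by transfer (subst Bochner_Integration.integral_cnj[symmetric], simp add: mult.commute)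
    then show ?thesis
      by (simp add: inner_L2_def)
  qed
  show "inner (f + g) h = inner f h + inner g h"
  proof -
    have "cinner_L2 (f + g) h = cinner_L2 f h + cinner_L2 g h"
      by transfer (auto simp: L2_rel_def distrib_right square_integrable_mult_cnj
          intro!: Bochner_Integration.integral_add)
    then show ?thesis
      by (simp add: inner_L2_def)
  qed
  show "inner (r *\<^sub>R f) g = r * inner f g"
  proof -
    have "cinner_L2 (scaleC_L2 c f) g = c * cinner_L2 f g" for c
      by transfer (simp add: mult.assoc)
    then show ?thesis
      by (simp add: inner_L2_def scaleR_L2_def)
  qed
  have self: "Re (cinner_L2 f f) \<ge> 0 \<and> (Re (cinner_L2 f f) = 0 \<longrightarrow> f = 0)"
  proof (transfer, goal_cases)
    case (1 f)
    then have f: "square_integrable f"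
      by (simp add: L2_rel_def)
    have eq: "Re (integral\<^sup>L lebesgue (\<lambda>x. f x * cnj (f x))) = integral\<^sup>L lebesgue (\<lambda>x. (cmod (f x))\<^sup>2)"
      by (subst integral_Re[OF square_integrable_mult_cnj[OF f f], symmetric])
         (simp add: cmod_power2 flip: power2_eq_square)
    have "AE x in lebesgue. f x = 0" if "integral\<^sup>L lebesgue (\<lambda>x. (cmod (f x))\<^sup>2) = 0"
      using that f integral_nonneg_eq_0_iff_AE[of lebesgue "\<lambda>x. (cmod (f x))\<^sup>2"]
      by (auto simp: square_integrable_def)
    then show ?case
      unfolding eq using f by (auto simp: L2_rel_def square_integrable_zero)
  qed
  have zero: "cinner_L2 0 0 = 0"
    by transfer simp
  show "0 \<le> inner f f"
    using self by (simp add: inner_L2_def)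
  show "inner f f = 0 \<longleftrightarrow> f = 0"
    using self zero by (auto simp: inner_L2_def)
  show "norm f = sqrt (inner f f)"
    by (simp add: norm_L2_def inner_L2_def)
qed

end

interpretation L2: vector_space scaleC_L2
proof
  fix a b :: complex and f g :: L2
  show "scaleC_L2 a (f + g) = scaleC_L2 a f + scaleC_L2 a g"
    by transfer (auto simp: L2_rel_def distrib_left distrib_right
        intro!: square_integrable_add square_integrable_cmult)
  show "scaleC_L2 (a + b) f = scaleC_L2 a f + scaleC_L2 b f"
    by transfer (auto simp: L2_rel_def distrib_left distrib_right
        intro!: square_integrable_add square_integrable_cmult)
  show "scaleC_L2 a (scaleC_L2 b f) = scaleC_L2 (a * b) f"
    by transfer (auto simp: L2_rel_def mult.assoc intro!: square_integrable_cmult)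
  show "scaleC_L2 1 f = f"
    by transfer (auto simp: L2_rel_def)
qed

definition orthonormal_basis :: "L2 set \<Rightarrow> bool" where
  "orthonormal_basis B \<longleftrightarrow>
     (\<forall>e\<in>B. norm e = 1) \<and> pairwise (\<lambda>e f. cinner_L2 e f = 0) B \<and> closure (L2.span B) = UNIV"


section \<open>Operators\<close>

definition bounded_operator :: "(L2 \<Rightarrow> L2) \<Rightarrow> bool" where
  "bounded_operator V \<longleftrightarrow>
     bounded_linear V \<and> (\<forall>c f. V (scaleC_L2 c f) = scaleC_L2 c (V f))"

text \<open>Unitary maps from a complex-linear subspace \<open>H\<close> onto a complex-linear subspace \<open>K\<close>;
  the values outside \<open>H\<close> are irrelevant.\<close>

definition unitary_between :: "L2 set \<Rightarrow> L2 set \<Rightarrow> (L2 \<Rightarrow> L2) \<Rightarrow> bool" where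
  "unitary_between H K W \<longleftrightarrow>
     (\<forall>f\<in>H. \<forall>g\<in>H. W (f + g) = W f + W g) \<and>
     (\<forall>c. \<forall>f\<in>H. W (scaleC_L2 c f) = scaleC_L2 c (W f)) \<and>
     (\<forall>f\<in>H. \<forall>g\<in>H. cinner_L2 (W f) (W g) = cinner_L2 f g) \<and>
     W ` H = K"

abbreviation unitary_operator :: "(L2 \<Rightarrow> L2) \<Rightarrow> bool" where
  "unitary_operator \<equiv> unitary_between UNIV UNIV"

text \<open>Integer powers, meaningful for bijective operators.\<close>

definition op_power :: "(L2 \<Rightarrow> L2) \<Rightarrow> int \<Rightarrow> L2 \<Rightarrow> L2" where
  "op_power A n = (if 0 \<le> n then A ^^ nat n else inv A ^^ nat (- n))"

lift_definition dilation :: "L2 \<Rightarrow> L2" is "\<lambda>f x. complex_of_real (sqrt 2) * f (2 * x)"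
  using L2_rel_affine[of 2 _ _ _ 0] by simp

lift_definition translation :: "L2 \<Rightarrow> L2" is "\<lambda>f x. f (x + 1)"
  using L2_rel_affine[of 1 _ _ 1 1] by (simp add: add.commute)


section \<open>Wavelets and their core spaces\<close>

lift_definition affine_copy :: "int \<Rightarrow> int \<Rightarrow> L2 \<Rightarrow> L2"
  is "\<lambda>j n f x. complex_of_real (2 powr (real_of_int j / 2)) * f (2 powi j * x + real_of_int n)"
  subgoal for j n f g
    using L2_rel_affine[of "2 powi j" f g _ "real_of_int n"] by (simp add: add.commute)
  done

lemma affine_copy_zero: "affine_copy 0 0 f = f"
  by transfer (auto simp: L2_rel_def)

lemma affine_copy_dilate: "affine_copy j 0 (affine_copy k n f) = affine_copy (j + k) n f"
proof (transfer, goal_cases)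
  case (1 j k n f)
  have "complex_of_real (2 powr (real_of_int j / 2)) * (complex_of_real (2 powr (real_of_int k / 2))
          * f (2 powi k * (2 powi j * x + real_of_int 0) + real_of_int n))
      = complex_of_real (2 powr (real_of_int (j + k) / 2)) * f (2 powi (j + k) * x + real_of_int n)" for x
    by (simp add: add_divide_distrib powr_add power_int_add mult.assoc mult.left_commute)
  moreover have "L2_rel (\<lambda>x. complex_of_real (2 powr (real_of_int (j + k) / 2)) * f (real_of_int n + 2 powi (j + k) * x))
      (\<lambda>x. complex_of_real (2 powr (real_of_int (j + k) / 2)) * f (real_of_int n + 2 powi (j + k) * x))"
    by (rule L2_rel_affine) (use 1 in auto)
  ultimately show ?case
    by (simp add: add.commute)
qed

lemma affine_copy_translate: "affine_copy 0 l (affine_copy 0 m f) = affine_copy 0 (l + m) f"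
proof (transfer, goal_cases)
  case (1 l m f)
  then have "L2_rel (\<lambda>x. 1 * f (real_of_int (l + m) + 1 * x)) (\<lambda>x. 1 * f (real_of_int (l + m) + 1 * x))"
    by (intro L2_rel_affine) auto
  then show ?case
    by (simp add: algebra_simps)
qed

lemma dilation_eq_affine_copy: "dilation = affine_copy 1 0"
proof
  show "dilation f = affine_copy 1 0 f" for f
  proof (transfer, goal_cases)
    case (1 f)
    then show ?case
      using L2_rel_affine[of 2 f f "complex_of_real (sqrt 2)" 0] by (simp add: powr_half_sqrt)
  qed
qed

lemma translation_eq_affine_copy: "translation = affine_copy 0 1"
proof
  show "translation f = affine_copy 0 1 f" for f
  proof (transfer, goal_cases)
    case (1 f)
    then show ?case
      using L2_rel_affine[of 1 f f 1 1] by (simp add: add.commute)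
  qed
qed

lemma op_power_one_parameter:
  assumes zero: "\<And>f. G 0 f = f" and add: "\<And>j k f. G j (G k f) = G (j + k) f"
  shows "op_power (G 1) n = G n"
proof -
  have pow: "(G j ^^ k) f = G (int k * j) f" for j k f
    by (induction k) (auto simp: zero add algebra_simps)
  have "inv (G 1) = G (- 1)"
    by (rule inv_unique_comp) (auto simp: fun_eq_iff zero add)
  then show ?thesis
    unfolding op_power_def by (simp add: fun_eq_iff[of _ "G n"] pow)
qed

lemma bij_dilation: "bij dilation" and bij_translation: "bij translation"
  unfolding dilation_eq_affine_copy translation_eq_affine_copy
  by (rule o_bij[of "affine_copy (- 1) 0"] o_bij[of "affine_copy 0 (- 1)"],
      auto simp: fun_eq_iff affine_copy_zero affine_copy_dilate affine_copy_translate)+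

lemma affine_copy_eq: "affine_copy j n f = op_power dilation j (op_power translation n f)"
proof -
  have "op_power dilation j = affine_copy j 0"
    unfolding dilation_eq_affine_copy
    by (rule op_power_one_parameter[of "\<lambda>j. affine_copy j 0"])
       (auto simp: affine_copy_zero affine_copy_dilate)
  moreover have "op_power translation n = affine_copy 0 n"
    unfolding translation_eq_affine_copy
    by (rule op_power_one_parameter) (auto simp: affine_copy_zero affine_copy_translate)
  ultimately show ?thesis
    by (simp add: affine_copy_dilate)
qed

definition wavelet :: "L2 \<Rightarrow> bool" where
  "wavelet \<psi> \<longleftrightarrow> orthonormal_basis {affine_copy j n \<psi> | j n. True}"

definition local_commutant :: "(L2 \<Rightarrow> L2) \<Rightarrow> (L2 \<Rightarrow> L2) \<Rightarrow> L2 \<Rightarrow> (L2 \<Rightarrow> L2) set" where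
  "local_commutant D T \<psi> =
     {V. bounded_operator V \<and>
         (\<forall>n l. V (op_power D n (op_power T l \<psi>)) = op_power D n (op_power T l (V \<psi>)))}"

definition core_space :: "L2 \<Rightarrow> L2 set" where
  "core_space \<psi> =
     closure (L2.span {op_power dilation n (op_power translation l \<psi>) | n l. n < 0})"

definition core_representation :: "L2 \<Rightarrow> int \<Rightarrow> L2 \<Rightarrow> L2" where
  "core_representation \<psi> l = restrict (op_power translation l) (core_space \<psi>)"

text \<open>Unitary equivalence of representations \<open>\<pi>\<close> on \<open>H\<close> and \<open>\<rho>\<close> on \<open>K\<close> of the additive group
  of integers.\<close>

definition unitarily_equivalent ::
    "L2 set \<Rightarrow> (int \<Rightarrow> L2 \<Rightarrow> L2) \<Rightarrow> L2 set \<Rightarrow> (int \<Rightarrow> L2 \<Rightarrow> L2) \<Rightarrow> bool" where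
  "unitarily_equivalent H \<pi> K \<rho> \<longleftrightarrow>
     (\<exists>W. unitary_between H K W \<and> (\<forall>l. \<forall>f\<in>H. W (\<pi> l f) = \<rho> l (W f)))"

definition core_equivalent :: "L2 \<Rightarrow> L2 \<Rightarrow> bool" where
  "core_equivalent \<psi> \<phi> \<longleftrightarrow>
     unitarily_equivalent (core_space \<psi>) (core_representation \<psi>)
       (core_space \<phi>) (core_representation \<phi>)"

end

theory Submission
  imports Defs
begin

text \<open>
  Since \<open>U\<^sup>n\<close> commutes with \<open>D\<^sup>j T\<^sup>l\<close> at \<open>\<psi>\<close>, it maps the wavelet basis of \<open>\<psi>\<close> onto that of \<open>U\<^sup>n \<psi>\<close>, and a
  unitary image of an orthonormal basis is an orthonormal basis.

  For the same reason \<open>U\<^sup>n\<close> maps the core space of \<open>\<psi>\<close> onto that of \<open>U\<^sup>n \<psi>\<close>. It need not intertwine the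
  translations there, however: \<open>T D\<^sup>j\<close> has the form \<open>D\<^sup>j T\<^sup>l\<close> with integral \<open>l\<close> only for \<open>j \<ge> 0\<close>
  (\<open>translate_affine_copy\<close>), whereas the core space is spanned by the levels \<open>j < 0\<close>. So \<open>U\<close> has to be
  modified. Let \<open>M\<close> be the closed span of all \<open>U\<^sup>n D\<^sup>j T\<^sup>l \<psi>\<close> with \<open>n \<in> \<int>\<close> and \<open>j \<ge> 0\<close>. It is invariant
  under \<open>U\<^sup>\<plusminus>\<^sup>1\<close> and \<open>T\<^sup>\<plusminus>\<^sup>1\<close>, and all powers of \<open>U\<close> commute with \<open>T\<close> on it:
  \<open>U\<^sup>k T U\<^sup>n D\<^sup>j T\<^sup>l \<psi> = U\<^sup>k\<^sup>+\<^sup>n T D\<^sup>j T\<^sup>l \<psi> = T U\<^sup>k\<^sup>+\<^sup>n D\<^sup>j T\<^sup>l \<psi>\<close>, because \<open>T D\<^sup>j T\<^sup>l \<psi>\<close> again belongs to the wavelet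
  basis. Let \<open>W\<close> be \<open>U\<^sup>k\<close> on \<open>M\<close> and the identity on the orthogonal complement of \<open>M\<close>
  (\<open>unitary_glue_identity\<close>). Then \<open>W\<close> is unitary and commutes with \<open>T\<close> on the whole space
  (\<open>unitary_glue_identity_commutes\<close>).

  It also maps the core space of \<open>U\<^sup>m \<psi>\<close> onto that of \<open>U\<^sup>m\<^sup>+\<^sup>k \<psi>\<close>, because the core space of a wavelet is
  the orthogonal complement of its levels \<open>j \<ge> 0\<close> (\<open>core_space_eq_ortho\<close>), and these lie in \<open>M\<close>, where
  \<open>W\<close> is \<open>U\<^sup>k\<close>. Hence \<open>W\<close> is the required equivalence with \<open>k = n - m\<close>.

  Two facts of analysis support this. Splitting the space along \<open>M\<close> uses the projection theorem and
  therefore the completeness of the space of square-integrable functions. That different levels of a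
  wavelet basis are orthogonal uses that no nonzero square-integrable function is invariant under a
  dilation (\<open>affine_copy_fixed_eq_0\<close>).
\<close>

section \<open>Completeness of the space of square-integrable functions\<close>

lemma L2_rel_refl_iff [simp]: "L2_rel f f \<longleftrightarrow> square_integrable f"
  by (simp add: L2_rel_def)

lemma Re_mult_cnj_self: "Re (z * cnj z) = (cmod z)\<^sup>2"
  unfolding cmod_power2 by (simp add: power2_eq_square)

lemma nn_integral_dist_abs_L2:
  assumes "square_integrable f" "square_integrable g"
  shows "(\<integral>\<^sup>+x. ennreal ((cmod (f x - g x))\<^sup>2) \<partial>lebesgue) = ennreal ((dist (abs_L2 f) (abs_L2 g))\<^sup>2)"
proof -
  have d: "square_integrable (\<lambda>x. f x - g x)"
    using assms by (rule square_integrable_diff)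
  have "cinner_L2 (abs_L2 f - abs_L2 g) (abs_L2 f - abs_L2 g)
      = (\<integral>x. (f x - g x) * cnj (f x - g x) \<partial>lebesgue)"
    using assms d by (simp add: minus_L2.abs_eq cinner_L2.abs_eq)
  also have "Re \<dots> = (\<integral>x. (cmod (f x - g x))\<^sup>2 \<partial>lebesgue)"
    by (subst integral_Re[OF square_integrable_mult_cnj[OF d d], symmetric])
       (simp only: Re_mult_cnj_self)
  finally have "(norm (abs_L2 f - abs_L2 g))\<^sup>2 = (\<integral>x. (cmod (f x - g x))\<^sup>2 \<partial>lebesgue)"
    by (simp add: power2_norm_eq_inner inner_L2_def)
  then show ?thesis
    using d by (subst nn_integral_eq_integral) (auto simp: square_integrable_def dist_norm)
qed

text \<open>With \<open>d\<^sub>n = F\<^sub>n\<^sub>+\<^sub>1 - F\<^sub>n\<close>, the weighted series \<open>\<Sum> 2\<^sup>n \<bar>d\<^sub>n\<bar>\<^sup>2\<close> has a finite integral, hence is finite almost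
  everywhere. At such a point \<open>\<bar>d\<^sub>n\<bar>\<close> is eventually below the terms of a convergent geometric series, and the
  telescoping sum converges absolutely.\<close>

lemma AE_convergent_if_L2_summable:
  assumes F: "\<And>n. square_integrable (F n)"
    and dist: "\<And>n. dist (abs_L2 (F (Suc n))) (abs_L2 (F n)) \<le> (1/2) ^ n"
  shows "AE x in lebesgue. convergent (\<lambda>n. F n x)"
proof -
  note [measurable] = square_integrable_measurable[OF F]
  let ?d = "\<lambda>n x. (cmod (F (Suc n) x - F n x))\<^sup>2"
  have "(\<integral>\<^sup>+x. (\<Sum>n. ennreal (2 ^ n * ?d n x)) \<partial>lebesgue)
      = (\<Sum>n. \<integral>\<^sup>+x. ennreal (2 ^ n * ?d n x) \<partial>lebesgue)"
    by (rule nn_integral_suminf) measurable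
  also have "\<dots> = (\<Sum>n. ennreal (2 ^ n * (dist (abs_L2 (F (Suc n))) (abs_L2 (F n)))\<^sup>2))"
    by (simp add: ennreal_mult nn_integral_cmult nn_integral_dist_abs_L2 F)
  also have "\<dots> \<le> (\<Sum>n. ennreal ((1/2) ^ n))"
  proof (intro suminf_le ennreal_leI)
    fix n
    have "2 ^ n * (dist (abs_L2 (F (Suc n))) (abs_L2 (F n)))\<^sup>2 \<le> 2 ^ n * ((1/2) ^ n)\<^sup>2"
      by (intro mult_left_mono power_mono dist) auto
    also have "\<dots> = (1/2 :: real) ^ n"
      by (simp add: power2_eq_square field_simps)
    finally show "2 ^ n * (dist (abs_L2 (F (Suc n))) (abs_L2 (F n)))\<^sup>2 \<le> (1/2) ^ n" .
  qed auto
  also have "\<dots> < \<infinity>"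
    by (subst suminf_ennreal_eq[OF _ geometric_sums]) auto
  finally have "AE x in lebesgue. (\<Sum>n. ennreal (2 ^ n * ?d n x)) \<noteq> \<infinity>"
    by (intro nn_integral_noteq_infinite) auto
  then show ?thesis
  proof (rule AE_mp, intro AE_I2 impI)
    fix x assume "(\<Sum>n. ennreal (2 ^ n * ?d n x)) \<noteq> \<infinity>"
    then have "summable (\<lambda>n. 2 ^ n * ?d n x)"
      by (intro summable_suminf_not_top) auto
    then have "(\<lambda>n. 2 ^ n * ?d n x) \<longlonglongrightarrow> 0"
      by (rule summable_LIMSEQ_zero)
    then have "eventually (\<lambda>n. 2 ^ n * ?d n x < 1) sequentially"
      by (rule order_tendstoD) simp
    then have "eventually (\<lambda>n. norm (F (Suc n) x - F n x) \<le> (1 / sqrt 2) ^ n) sequentially"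
    proof eventually_elim
      case (elim n)
      have "((1 / sqrt 2) ^ n)\<^sup>2 = (1/2 :: real) ^ n"
        by (simp add: power_mult[symmetric] mult.commute[of n] power_divide)
           (simp add: power_mult)
      then have "?d n x \<le> ((1 / sqrt 2) ^ n)\<^sup>2"
        using elim by (simp add: field_simps)
      then show ?case
        by (rule power2_le_imp_le) simp
    qed
    then have "summable (\<lambda>n. F (Suc n) x - F n x)"
      by (rule summable_comparison_test_ev) (auto intro: summable_geometric)
    then have "convergent (\<lambda>n. \<Sum>i<n. F (Suc i) x - F i x)"
      by (simp add: summable_iff_convergent)
    then have "convergent (\<lambda>n. F n x - F 0 x)"
      unfolding sum_lessThan_telescope[of "\<lambda>n. F n x"] .
    from convergent_add[OF this convergent_const[of "F 0 x"]]
    show "convergent (\<lambda>n. F n x)"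
      by simp
  qed
qed

text \<open>The pointwise limit of the representatives is also the limit in mean: Fatou's lemma bounds its
  distance to each term of the sequence by the tail of the geometric series.\<close>

lemma convergent_if_L2_summable:
  fixes X :: "nat \<Rightarrow> L2"
  assumes X: "\<And>n. dist (X (Suc n)) (X n) \<le> (1/2) ^ n"
  shows "convergent X"
proof -
  have "\<exists>f. square_integrable f \<and> X n = abs_L2 f" for n
    by (induction "X n" rule: L2.abs_induct) auto
  then obtain F where F: "\<And>n. square_integrable (F n)" and X_eq: "\<And>n. X n = abs_L2 (F n)"
    by metis
  note [measurable] = square_integrable_measurable[OF F]
  define f where "f x = lim (\<lambda>n. F n x)" for x
  have [measurable]: "f \<in> borel_measurable lebesgue"
    unfolding f_def by measurable
  have conv: "AE x in lebesgue. (\<lambda>n. F n x) \<longlonglongrightarrow> f x"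
    using AE_convergent_if_L2_summable[OF F X[unfolded X_eq]]
    by (auto simp: f_def convergent_LIMSEQ_iff)
  have dist_le: "dist (X m) (X n) \<le> 2 * (1/2) ^ n" if "n \<le> m" for m n
  proof -
    have "dist (X (n + k)) (X n) \<le> 2 * (1/2) ^ n - 2 * (1/2) ^ (n + k)" for k
    proof (induction k)
      case (Suc k)
      have "dist (X (n + Suc k)) (X n) \<le> dist (X (Suc (n + k))) (X (n + k)) + dist (X (n + k)) (X n)"
        using dist_triangle by auto
      then show ?case
        using Suc X[of "n + k"] by simp
    qed simp
    from this[of "m - n"] that have "dist (X m) (X n) \<le> 2 * (1/2) ^ n - 2 * (1/2) ^ m"
      by simp
    moreover have "0 \<le> (1/2 :: real) ^ m"
      by simp
    ultimately show ?thesis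
      by linarith
  qed
  have fatou: "(\<integral>\<^sup>+x. ennreal ((cmod (f x - F n x))\<^sup>2) \<partial>lebesgue) \<le> ennreal ((2 * (1/2) ^ n)\<^sup>2)" for n
  proof -
    have "(\<integral>\<^sup>+x. ennreal ((cmod (f x - F n x))\<^sup>2) \<partial>lebesgue)
        = (\<integral>\<^sup>+x. liminf (\<lambda>m. ennreal ((cmod (F m x - F n x))\<^sup>2)) \<partial>lebesgue)"
    proof (rule nn_integral_cong_AE, use conv in eventually_elim)
      case (elim x)
      have "(\<lambda>m. ennreal ((cmod (F m x - F n x))\<^sup>2)) \<longlonglongrightarrow> ennreal ((cmod (f x - F n x))\<^sup>2)"
        by (intro tendsto_ennrealI tendsto_intros elim)
      then show ?case
        by (intro lim_imp_Liminf[symmetric]) simp_all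
    qed
    also have "\<dots> \<le> liminf (\<lambda>m. \<integral>\<^sup>+x. ennreal ((cmod (F m x - F n x))\<^sup>2) \<partial>lebesgue)"
      by (rule nn_integral_liminf) measurable
    also have "\<dots> = liminf (\<lambda>m. ennreal ((dist (X m) (X n))\<^sup>2))"
      by (simp add: nn_integral_dist_abs_L2 F X_eq)
    also have "\<dots> \<le> liminf (\<lambda>m. ennreal ((2 * (1/2) ^ n)\<^sup>2))"
      by (intro Liminf_mono eventually_sequentiallyI[of n] ennreal_leI power_mono dist_le) auto
    finally show ?thesis
      by (simp add: Liminf_const)
  qed
  have "square_integrable (\<lambda>x. f x - F 0 x)"
    unfolding square_integrable_def
    using fatou[of 0] by (auto simp: integrable_iff_bounded intro: le_less_trans)
  from square_integrable_add[OF this F[of 0]] have f: "square_integrable f"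
    by simp
  have "dist (X n) (abs_L2 f) \<le> 2 * (1/2) ^ n" for n
  proof -
    have "ennreal ((dist (abs_L2 f) (X n))\<^sup>2) \<le> ennreal ((2 * (1/2) ^ n)\<^sup>2)"
      using fatou[of n] by (simp add: nn_integral_dist_abs_L2 f F X_eq)
    then have "(dist (abs_L2 f) (X n))\<^sup>2 \<le> (2 * (1/2) ^ n)\<^sup>2"
      by (subst (asm) ennreal_le_iff) auto
    then show ?thesis
      by (subst dist_commute) (rule power2_le_imp_le, auto)
  qed
  moreover have "(\<lambda>n. 2 * (1/2 :: real) ^ n) \<longlonglongrightarrow> 0"
    by (intro tendsto_mult_right_zero LIMSEQ_power_zero) auto
  ultimately have "X \<longlonglongrightarrow> abs_L2 f"
    by (intro metric_tendsto_imp_tendsto[of "\<lambda>n. 2 * (1/2 :: real) ^ n" 0 _ X]) auto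
  then show ?thesis
    by (rule convergentI)
qed

text \<open>A Cauchy sequence has a subsequence with the rate that the preceding lemma requires, and it
  converges as soon as one of its subsequences does.\<close>

instance L2 :: complete_space
proof
  fix X :: "nat \<Rightarrow> L2" assume X: "Cauchy X"
  \<comment> \<open>The partial sums dominate each \<open>N n\<close> and increase strictly, which \<open>N\<close> itself need not do.\<close>
  have "\<forall>n. \<exists>N. \<forall>i\<ge>N. \<forall>j\<ge>N. dist (X i) (X j) < (1/2) ^ n"
    using X by (intro allI metric_CauchyD) auto
  then obtain N where N: "\<And>n i j. i \<ge> N n \<Longrightarrow> j \<ge> N n \<Longrightarrow> dist (X i) (X j) < (1/2) ^ n"
    by metis
  define r where "r n = (\<Sum>i\<le>n. Suc (N i))" for n
  have r: "strict_mono r"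
    by (rule strict_monoI_Suc) (simp add: r_def)
  have "dist ((X \<circ> r) (Suc n)) ((X \<circ> r) n) \<le> (1/2) ^ n" for n
  proof -
    have "N n \<le> r n"
      unfolding r_def by (cases n) auto
    moreover have "r n \<le> r (Suc n)"
      by (simp add: r_def)
    ultimately show ?thesis
      using N[of n "r (Suc n)" "r n"] by simp
  qed
  then have "convergent (X \<circ> r)"
    by (rule convergent_if_L2_summable)
  then obtain l where "(X \<circ> r) \<longlonglongrightarrow> l"
    by (auto simp: convergent_def)
  then show "convergent X"
    using Cauchy_converges_subseq[OF X r] by (auto simp: convergent_def o_def)
qed

section \<open>Orthogonal projections\<close>

text \<open>Hilbert's projection theorem. By the parallelogram law a sequence in \<open>C\<close> whose distances to \<open>f\<close>
  tend to the infimum is Cauchy; its limit \<open>a\<close> is a nearest point, and if \<open>f - a\<close> were not orthogonal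
  to some \<open>c\<close>, moving \<open>a\<close> along \<open>c\<close> would come closer to \<open>f\<close>.\<close>

lemma exists_orthogonal_projection:
  fixes C :: "'a :: {real_inner, complete_space} set"
  assumes C: "subspace C" "closed C"
  shows "\<exists>a\<in>C. \<forall>c\<in>C. inner (f - a) c = 0"
proof -
  define d where "d = infdist f C"
  have ne: "C \<noteq> {}"
    using subspace_0[OF C(1)] by auto
  have d: "d \<ge> 0" "\<And>c. c \<in> C \<Longrightarrow> d \<le> norm (f - c)"
    by (auto simp: d_def infdist_nonneg dist_norm[symmetric] infdist_le)
  have "\<exists>c\<in>C. norm (f - c) < d + 1 / Suc n" for n
    using cInf_lessD[of "(\<lambda>c. dist f c) ` C" "d + 1 / Suc n"] ne
    by (auto simp: d_def infdist_def dist_norm)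
  then obtain x where xC: "\<And>n. x n \<in> C" and x: "\<And>n. norm (f - x n) < d + 1 / Suc n"
    by metis
  have x_sq: "(norm (f - x n))\<^sup>2 \<le> d\<^sup>2 + (2 * d + 1) / Suc n" for n
  proof -
    define e :: real where "e = 1 / Suc n"
    have "e * e \<le> 1 * e"
      unfolding e_def by (intro mult_right_mono) auto
    moreover have "(norm (f - x n))\<^sup>2 \<le> (d + e)\<^sup>2"
      using x[of n] unfolding e_def by (intro power_mono) auto
    ultimately have "(norm (f - x n))\<^sup>2 \<le> d\<^sup>2 + (2 * d + 1) * e"
      by (simp add: power2_eq_square algebra_simps)
    then show ?thesis
      by (simp add: e_def)
  qed
  have dist_sq: "(dist (x m) (x n))\<^sup>2 \<le> 4 * ((2 * d + 1) / Suc N)" if "m \<ge> N" "n \<ge> N" for m n N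
  proof -
    have "(1/2) *\<^sub>R (x m + x n) \<in> C"
      using xC C(1) by (intro subspace_mul subspace_add)
    from d(2)[OF this] have "d\<^sup>2 \<le> (norm (f - (1/2) *\<^sub>R (x m + x n)))\<^sup>2"
      using d(1) by (intro power_mono)
    \<comment> \<open>The parallelogram law for \<open>f - x m\<close> and \<open>f - x n\<close>.\<close>
    moreover have "(norm (x m - x n))\<^sup>2 + 4 * (norm (f - (1/2) *\<^sub>R (x m + x n)))\<^sup>2
        = 2 * (norm (f - x m))\<^sup>2 + 2 * (norm (f - x n))\<^sup>2"
      by (simp add: power2_norm_eq_inner inner_diff inner_add inner_commute algebra_simps)
    moreover have "(2 * d + 1) / Suc m \<le> (2 * d + 1) / Suc N" "(2 * d + 1) / Suc n \<le> (2 * d + 1) / Suc N"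
      using that d(1) by (auto intro!: divide_left_mono)
    ultimately show ?thesis
      using x_sq[of m] x_sq[of n] unfolding dist_norm by linarith
  qed
  have "Cauchy x"
  proof (rule metric_CauchyI)
    fix e :: real assume e: "e > 0"
    obtain N :: nat where N: "4 * (2 * d + 1) / e\<^sup>2 < N"
      using reals_Archimedean2 by blast
    have "4 * (2 * d + 1) < e\<^sup>2 * real (Suc N)"
      using N e by (simp add: field_simps) (smt (verit) zero_less_power)
    then have "4 * ((2 * d + 1) / Suc N) < e\<^sup>2"
      by (simp add: field_simps)
    then show "\<exists>M. \<forall>m\<ge>M. \<forall>n\<ge>M. dist (x m) (x n) < e"
      using e by (meson dist_sq le_less_trans power_less_imp_less_base less_imp_le)
  qed
  then obtain a where a: "x \<longlonglongrightarrow> a"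
    using Cauchy_convergent convergent_def by blast
  have aC: "a \<in> C"
    using C(2) xC a by (rule closed_sequentially)
  have "(\<lambda>n. d + 1 / Suc n) \<longlonglongrightarrow> d + 0"
    by (intro tendsto_intros LIMSEQ_Suc lim_1_over_n)
  then have lim_d: "(\<lambda>n. d + 1 / Suc n) \<longlonglongrightarrow> d"
    by simp
  have lim_norm: "(\<lambda>n. norm (f - x n)) \<longlonglongrightarrow> norm (f - a)"
    by (intro tendsto_intros a)
  have a_le: "norm (f - a) \<le> d"
    by (rule LIMSEQ_le[OF lim_norm lim_d]) (intro exI allI impI less_imp_le x)
  have "inner (f - a) c = 0" if c: "c \<in> C" for c
  proof (rule ccontr)
    assume nz: "inner (f - a) c \<noteq> 0"
    \<comment> \<open>The minimiser of the quadratic \<open>t \<mapsto> \<parallel>f - (a + t c)\<parallel>\<^sup>2\<close>.\<close>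
    define t where "t = inner (f - a) c / inner c c"
    have cc: "inner c c > 0"
      using nz by auto
    have "a + t *\<^sub>R c \<in> C"
      using aC c C(1) by (intro subspace_mul subspace_add)
    from d(2)[OF this] have "(norm (f - a))\<^sup>2 \<le> (norm (f - (a + t *\<^sub>R c)))\<^sup>2"
      using a_le d(1) by (intro power_mono) auto
    also have "\<dots> = (norm (f - a))\<^sup>2 - 2 * t * inner (f - a) c + t * t * inner c c"
      by (simp add: power2_norm_eq_inner inner_diff inner_add inner_commute algebra_simps)
    also have "\<dots> = (norm (f - a))\<^sup>2 - (inner (f - a) c)\<^sup>2 / inner c c"
      using cc by (simp add: t_def field_simps power2_eq_square)
    finally show False
      using cc nz by (simp add: field_simps)
  qed
  with aC show ?thesis
    by blast
qed

section \<open>The complex inner product\<close>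

lemma cinner_L2_commute: "cinner_L2 f g = cnj (cinner_L2 g f)"
  by transfer (subst Bochner_Integration.integral_cnj[symmetric], simp add: mult.commute)

lemma cinner_L2_add_left: "cinner_L2 (f + g) h = cinner_L2 f h + cinner_L2 g h"
  by transfer (auto simp: L2_rel_def distrib_right square_integrable_mult_cnj
      intro!: Bochner_Integration.integral_add)

lemma cinner_L2_scaleC_left: "cinner_L2 (scaleC_L2 c f) g = c * cinner_L2 f g"
  by transfer (simp add: mult.assoc)

lemma cinner_L2_add_right: "cinner_L2 h (f + g) = cinner_L2 h f + cinner_L2 h g"
  by (subst (1 2 3) cinner_L2_commute) (simp add: cinner_L2_add_left)

lemma cinner_L2_scaleC_right: "cinner_L2 g (scaleC_L2 c f) = cnj c * cinner_L2 g f"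
  by (subst (1 2) cinner_L2_commute) (simp add: cinner_L2_scaleC_left)

lemma cinner_L2_diff_left: "cinner_L2 (f - g) h = cinner_L2 f h - cinner_L2 g h"
  using cinner_L2_add_left[of "f - g" g h] by simp

lemma cinner_L2_diff_right: "cinner_L2 h (f - g) = cinner_L2 h f - cinner_L2 h g"
  using cinner_L2_add_right[of h "f - g" g] by simp

lemma cinner_L2_zero [simp]: "cinner_L2 0 f = 0" "cinner_L2 f 0 = 0"
  using cinner_L2_diff_left[of f f f] cinner_L2_diff_right[of f f f] by simp_all

lemma cinner_L2_eq_0_commute: "cinner_L2 f g = 0 \<longleftrightarrow> cinner_L2 g f = 0"
  by (subst cinner_L2_commute) simp

lemma cinner_L2_self_eq_0_iff: "cinner_L2 f f = 0 \<longleftrightarrow> f = 0"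
  by (metis cinner_L2_zero(1) inner_L2_def inner_eq_zero_iff zero_complex.sel(1))

text \<open>This reduces continuity of the complex inner product, and complex orthogonality to a complex
  subspace, to the corresponding facts about the real inner product.\<close>

lemma cinner_L2_eq_inner: "cinner_L2 f g = Complex (inner f g) (inner f (scaleC_L2 \<i> g))"
  by (simp add: inner_L2_def cinner_L2_scaleC_right complex_eq_iff)

lemma norm_scaleC_L2: "norm (scaleC_L2 c f) = cmod c * norm f"
proof -
  have "Im (cinner_L2 f f) = 0"
    using arg_cong[OF cinner_L2_commute[of f f], of Im] by simp
  then have "inner (scaleC_L2 c f) (scaleC_L2 c f) = (cmod c)\<^sup>2 * inner f f"
    unfolding inner_L2_def cinner_L2_scaleC_left cinner_L2_scaleC_right cmod_power2
    by (simp add: power2_eq_square algebra_simps)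
  then show ?thesis
    by (simp add: norm_eq_sqrt_inner real_sqrt_mult)
qed

lemma bounded_linear_scaleC_L2: "bounded_linear (scaleC_L2 c)"
proof (rule bounded_linear_intro)
  show "scaleC_L2 c (f + g) = scaleC_L2 c f + scaleC_L2 c g" for f g
    by (rule L2.scale_right_distrib)
  show "scaleC_L2 c (r *\<^sub>R f) = r *\<^sub>R scaleC_L2 c f" for r f
    by (simp add: scaleR_L2_def L2.scale_left_commute)
  show "norm (scaleC_L2 c f) \<le> norm f * cmod c" for f
    by (simp add: norm_scaleC_L2 mult.commute)
qed

section \<open>Orthogonal complements\<close>

definition ortho :: "L2 set \<Rightarrow> L2 set" where
  "ortho S = {f. \<forall>g\<in>S. cinner_L2 f g = 0}"

lemma orthoI: "(\<And>g. g \<in> S \<Longrightarrow> cinner_L2 f g = 0) \<Longrightarrow> f \<in> ortho S"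
  by (simp add: ortho_def)

lemma orthoD: "f \<in> ortho S \<Longrightarrow> g \<in> S \<Longrightarrow> cinner_L2 f g = 0"
  by (simp add: ortho_def)

lemma subspace_ortho: "L2.subspace (ortho S)"
  by (rule L2.subspaceI) (auto simp: ortho_def cinner_L2_add_left cinner_L2_scaleC_left)

lemma closed_ortho: "closed (ortho S)"
proof -
  have "ortho S = (\<Inter>g\<in>S. {f. inner f g = 0} \<inter> {f. inner f (scaleC_L2 \<i> g) = 0})"
    by (auto simp: ortho_def cinner_L2_eq_inner complex_eq_iff)
  then show ?thesis
    by (auto intro!: closed_INT closed_Int closed_Collect_eq continuous_intros)
qed

lemma ortho_antimono: "S \<subseteq> S' \<Longrightarrow> ortho S' \<subseteq> ortho S"
  by (auto simp: ortho_def)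

lemma subset_ortho_ortho: "S \<subseteq> ortho (ortho S)"
  by (auto simp: ortho_def cinner_L2_eq_0_commute)

lemma ortho_UNIV: "ortho UNIV = {0}"
  by (auto simp: ortho_def cinner_L2_self_eq_0_iff intro: cinner_L2_self_eq_0_iff[THEN iffD1])

lemma subspace_closure:
  assumes S: "L2.subspace S"
  shows "L2.subspace (closure S)"
proof (rule L2.subspaceI)
  show "0 \<in> closure S"
    using L2.subspace_0[OF S] closure_subset by blast
next
  fix f g assume "f \<in> closure S" "g \<in> closure S"
  then obtain x y where "\<And>n. x n \<in> S" "x \<longlonglongrightarrow> f" "\<And>n. y n \<in> S" "y \<longlonglongrightarrow> g"
    unfolding closure_sequential by metis
  then show "f + g \<in> closure S"
    unfolding closure_sequential using L2.subspace_add[OF S]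
    by (intro exI[of _ "\<lambda>n. x n + y n"]) (auto intro: tendsto_add)
next
  fix c f assume "f \<in> closure S"
  then obtain x where "\<And>n. x n \<in> S" "x \<longlonglongrightarrow> f"
    unfolding closure_sequential by metis
  then show "scaleC_L2 c f \<in> closure S"
    unfolding closure_sequential using L2.subspace_scale[OF S]
    by (intro exI[of _ "\<lambda>n. scaleC_L2 c (x n)"])
       (auto intro: bounded_linear.tendsto[OF bounded_linear_scaleC_L2])
qed

lemma closure_span_subset:
  assumes "S \<subseteq> C" "L2.subspace C" "closed C"
  shows "closure (L2.span S) \<subseteq> C"
  using assms by (intro closure_minimal L2.span_minimal)

lemma ortho_closure_span: "ortho (closure (L2.span S)) = ortho S"
proof
  show "ortho (closure (L2.span S)) \<subseteq> ortho S"
    by (intro ortho_antimono order.trans[OF L2.span_superset closure_subset])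
  have "closure (L2.span S) \<subseteq> ortho (ortho S)"
    by (intro closure_span_subset subset_ortho_ortho subspace_ortho closed_ortho)
  then show "ortho S \<subseteq> ortho (closure (L2.span S))"
    using subset_ortho_ortho[of "ortho S"] ortho_antimono by blast
qed

text \<open>The nearest point with respect to the real inner product serves here as well: a vector that is
  real-orthogonal to a subspace invariant under multiplication by \<open>\<i>\<close> is complex-orthogonal to it.\<close>

lemma exists_orthogonal_decomposition:
  assumes C: "L2.subspace C" "closed C"
  obtains a b where "a \<in> C" "b \<in> ortho C" "f = a + b"
proof -
  have "subspace C"
    using C(1) by (intro subspaceI) (auto simp: scaleR_L2_def L2.subspace_0 L2.subspace_add L2.subspace_scale)
  from exists_orthogonal_projection[OF this C(2), of f]
  obtain a where a: "a \<in> C" "\<And>c. c \<in> C \<Longrightarrow> inner (f - a) c = 0"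
    by blast
  have "f - a \<in> ortho C"
    using a(2) L2.subspace_scale[OF C(1)] by (intro orthoI) (simp add: cinner_L2_eq_inner complex_eq_iff)
  with a(1) that[of a "f - a"] show ?thesis
    by simp
qed

section \<open>Unitary operators\<close>

lemma unitary_add: "unitary_operator V \<Longrightarrow> V (f + g) = V f + V g"
  and unitary_scaleC: "unitary_operator V \<Longrightarrow> V (scaleC_L2 c f) = scaleC_L2 c (V f)"
  and unitary_cinner: "unitary_operator V \<Longrightarrow> cinner_L2 (V f) (V g) = cinner_L2 f g"
  and unitary_surj: "unitary_operator V \<Longrightarrow> surj V"
  by (auto simp: unitary_between_def)

lemma unitary_operatorI:
  assumes "\<And>f g. V (f + g) = V f + V g" "\<And>c f. V (scaleC_L2 c f) = scaleC_L2 c (V f)"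
    and "\<And>f g. cinner_L2 (V f) (V g) = cinner_L2 f g" "\<And>g. \<exists>f. V f = g"
  shows "unitary_operator V"
proof -
  have "surj V"
    unfolding surj_def using assms(4) by metis
  with assms(1-3) show ?thesis
    by (simp add: unitary_between_def)
qed

lemma unitary_diff: "unitary_operator V \<Longrightarrow> V (f - g) = V f - V g"
  using unitary_add[of V "f - g" g] by (simp add: algebra_simps)

lemma unitary_norm: "unitary_operator V \<Longrightarrow> norm (V f) = norm f"
  by (simp add: norm_L2_def unitary_cinner)

lemma unitary_bij:
  assumes V: "unitary_operator V"
  shows "bij V"
proof (rule bijI)
  show "inj V"
  proof (rule injI)
    fix f g assume "V f = V g"
    then have "norm (f - g) = 0"
      using unitary_norm[OF V, of "f - g"] by (simp add: unitary_diff[OF V])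
    then show "f = g"
      by simp
  qed
qed (rule unitary_surj[OF V])

lemma unitary_comp:
  assumes V: "unitary_operator V" and W: "unitary_operator W"
  shows "unitary_operator (\<lambda>f. V (W f))"
proof (rule unitary_operatorI)
  show "\<exists>f. V (W f) = g" for g
    using unitary_surj[OF V] unitary_surj[OF W] by (metis surjE)
qed (simp_all add: unitary_add[OF V] unitary_add[OF W] unitary_scaleC[OF V] unitary_scaleC[OF W]
      unitary_cinner[OF V] unitary_cinner[OF W])

lemma unitary_adjoint: "unitary_operator V \<Longrightarrow> cinner_L2 (V f) g = cinner_L2 f (inv V g)"
  by (metis unitary_cinner unitary_surj surj_f_inv_f)

lemma unitary_inv:
  assumes V: "unitary_operator V"
  shows "unitary_operator (inv V)"
proof (rule unitary_operatorI)
  have [simp]: "V (inv V f) = f" "inv V (V f) = f" for f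
    using unitary_bij[OF V] by (simp_all add: bij_is_surj surj_f_inv_f bij_is_inj inv_f_f)
  have eqI: "f = g" if "V f = V g" for f g
    using unitary_bij[OF V] that by (metis bij_pointE)
  show "inv V (f + g) = inv V f + inv V g" for f g
    by (rule eqI) (simp add: unitary_add[OF V])
  show "inv V (scaleC_L2 c f) = scaleC_L2 c (inv V f)" for c f
    by (rule eqI) (simp add: unitary_scaleC[OF V])
  show "cinner_L2 (inv V f) (inv V g) = cinner_L2 f g" for f g
    using unitary_cinner[OF V, of "inv V f" "inv V g"] by simp
  show "\<exists>f. inv V f = g" for g
    by (rule exI[of _ "V g"]) simp
qed

lemma unitary_image_ortho:
  assumes V: "unitary_operator V"
  shows "V ` ortho S = ortho (V ` S)"
proof
  show "V ` ortho S \<subseteq> ortho (V ` S)"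
    by (auto simp: ortho_def unitary_cinner[OF V])
  show "ortho (V ` S) \<subseteq> V ` ortho S"
  proof
    fix g assume g: "g \<in> ortho (V ` S)"
    obtain f where "g = V f"
      using unitary_surj[OF V] by (rule surjE)
    with g show "g \<in> V ` ortho S"
      by (auto simp: ortho_def unitary_cinner[OF V])
  qed
qed

text \<open>Although \<open>ortho (ortho S)\<close> is the closed span of \<open>S\<close>, no approximation is needed: for every \<open>h\<close> the
  vector \<open>V\<^sup>* h - W\<^sup>* h\<close> is orthogonal to \<open>S\<close>, hence to \<open>f\<close>, so \<open>V f - W f\<close> is orthogonal to every \<open>h\<close>.\<close>

lemma unitary_eq_on_ortho_ortho:
  assumes V: "unitary_operator V" and W: "unitary_operator W"
    and eq: "\<And>s. s \<in> S \<Longrightarrow> V s = W s" and f: "f \<in> ortho (ortho S)"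
  shows "V f = W f"
proof -
  define h where "h = V f - W f"
  have "inv V h - inv W h \<in> ortho S"
  proof (rule orthoI)
    fix s assume "s \<in> S"
    then have "cinner_L2 s (inv V h - inv W h) = 0"
      by (simp add: cinner_L2_diff_right unitary_adjoint[OF V, symmetric]
          unitary_adjoint[OF W, symmetric] eq)
    then show "cinner_L2 (inv V h - inv W h) s = 0"
      by (simp add: cinner_L2_eq_0_commute)
  qed
  then have "cinner_L2 f (inv V h - inv W h) = 0"
    by (rule orthoD[OF f])
  then have "cinner_L2 h h = 0"
    by (subst (1) h_def) (simp add: cinner_L2_diff_left cinner_L2_diff_right unitary_adjoint[OF V]
        unitary_adjoint[OF W])
  then show ?thesis
    by (simp add: cinner_L2_self_eq_0_iff h_def)
qed

text \<open>A unitary operator that permutes \<open>S\<close> leaves both summands of the decomposition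
  \<open>ortho S \<oplus> ortho (ortho S)\<close> invariant, so that on the first it can be replaced by the identity.
  This is how an operator is given good commutation relations outside of the part of the space on
  which it already has them.\<close>

lemma unitary_glue_identity:
  assumes A: "unitary_operator A" and AS: "A ` S = S"
  obtains W where "unitary_operator W"
    and "\<And>a b. a \<in> ortho S \<Longrightarrow> b \<in> ortho (ortho S) \<Longrightarrow> W (a + b) = a + A b"
proof -
  let ?N = "ortho S" and ?M = "ortho (ortho S)"
  have AM: "A ` ?M = ?M"
    by (simp add: unitary_image_ortho[OF A] AS)
  have zero: "f = 0" if "f \<in> ?N" "f \<in> ?M" for f
    using orthoD[OF that(2,1)] by (simp add: cinner_L2_self_eq_0_iff)
  have "\<exists>a. a \<in> ?N \<and> f - a \<in> ?M" for f
    using exists_orthogonal_decomposition[OF subspace_ortho closed_ortho, of S f]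
    by (metis add_diff_cancel_left')
  then obtain P where P: "\<And>f. P f \<in> ?N" "\<And>f. f - P f \<in> ?M"
    by metis
  have P_eq: "P (a + b) = a" if "a \<in> ?N" "b \<in> ?M" for a b
  proof -
    have "a - P (a + b) \<in> ?N"
      by (rule L2.subspace_diff[OF subspace_ortho that(1) P(1)])
    moreover have "(a + b - P (a + b)) - b \<in> ?M"
      by (rule L2.subspace_diff[OF subspace_ortho P(2) that(2)])
    ultimately show ?thesis
      using zero[of "a - P (a + b)"] by (simp add: algebra_simps)
  qed
  define W where "W f = P f + A (f - P f)" for f
  have W: "W (a + b) = a + A b" if "a \<in> ?N" "b \<in> ?M" for a b
    by (simp add: W_def P_eq that)
  have split: "\<exists>a b. f = a + b \<and> a \<in> ?N \<and> b \<in> ?M" for f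
    using P[of f] by (intro exI[of _ "P f"] exI[of _ "f - P f"]) simp
  have orth: "cinner_L2 a b = 0" "cinner_L2 b a = 0" if "a \<in> ?N" "b \<in> ?M" for a b
    using orthoD[OF that(2,1)] by (simp_all add: cinner_L2_eq_0_commute)
  have "unitary_operator W"
  proof (rule unitary_operatorI)
    fix f g c
    obtain a b where f: "f = a + b" "a \<in> ?N" "b \<in> ?M"
      using split by blast
    obtain a' b' where g: "g = a' + b'" "a' \<in> ?N" "b' \<in> ?M"
      using split by blast
    have "W ((a + a') + (b + b')) = (a + a') + A (b + b')"
      using f g by (intro W L2.subspace_add subspace_ortho)
    then show "W (f + g) = W f + W g"
      using f g by (simp add: W unitary_add[OF A] algebra_simps)
    have "W (scaleC_L2 c a + scaleC_L2 c b) = scaleC_L2 c a + A (scaleC_L2 c b)"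
      using f by (intro W L2.subspace_scale subspace_ortho)
    then show "W (scaleC_L2 c f) = scaleC_L2 c (W f)"
      using f by (simp add: W unitary_scaleC[OF A] L2.scale_right_distrib)
    have "A b \<in> ?M" "A b' \<in> ?M"
      using AM f g by blast+
    then show "cinner_L2 (W f) (W g) = cinner_L2 f g"
      using f g by (simp add: W cinner_L2_add_left cinner_L2_add_right orth unitary_cinner[OF A])
    obtain b'' where "b'' \<in> ?M" "b' = A b''"
      using AM g by blast
    then have "W (a' + b'') = g"
      using g by (simp add: W)
    then show "\<exists>f. W f = g" ..
  qed
  with W that show ?thesis
    by blast
qed

text \<open>The identity commutes with \<open>V\<close> on \<open>ortho S\<close>, and on \<open>ortho (ortho S)\<close> the commutation of \<open>A\<close> and \<open>V\<close>
  only has to be checked on the generators.\<close>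

lemma unitary_glue_identity_commutes:
  assumes A: "unitary_operator A" and V: "unitary_operator V" and VS: "V ` S = S"
    and comm: "\<And>s. s \<in> S \<Longrightarrow> A (V s) = V (A s)"
    and W: "\<And>a b. a \<in> ortho S \<Longrightarrow> b \<in> ortho (ortho S) \<Longrightarrow> W (a + b) = a + A b"
  shows "W (V f) = V (W f)"
proof -
  obtain a b where f: "a \<in> ortho S" "b \<in> ortho (ortho S)" "f = a + b"
    using exists_orthogonal_decomposition[OF subspace_ortho closed_ortho] by metis
  have "V a \<in> ortho S" "V b \<in> ortho (ortho S)"
    using f unitary_image_ortho[OF V] VS by (metis imageI)+
  then have "W (V f) = V a + A (V b)"
    using f by (simp add: unitary_add[OF V] W)
  also have "A (V b) = V (A b)"
    using comm f(2) by (rule unitary_eq_on_ortho_ortho[OF unitary_comp[OF A V] unitary_comp[OF V A]])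
  also have "V a + \<dots> = V (W f)"
    using f by (simp add: unitary_add[OF V] W)
  finally show ?thesis .
qed

lemma orthonormal_basis_unitary_image:
  assumes V: "unitary_operator V" "continuous_on UNIV V" and B: "orthonormal_basis B"
  shows "orthonormal_basis (V ` B)"
  unfolding orthonormal_basis_def
proof (intro conjI)
  show "\<forall>e\<in>V ` B. norm e = 1"
    using B by (auto simp: orthonormal_basis_def unitary_norm[OF V(1)])
  show "pairwise (\<lambda>e f. cinner_L2 e f = 0) (V ` B)"
    using B unfolding orthonormal_basis_def pairwise_def
    by (auto simp: unitary_cinner[OF V(1)])
  have "V f \<in> L2.span (V ` B)" if "f \<in> L2.span B" for f
    using that
  proof (induction rule: L2.span_induct_alt)
    case base
    show ?case
      using unitary_diff[OF V(1), of 0 0] by (simp add: L2.span_zero)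
  next
    case (step c x y)
    then show ?case
      unfolding unitary_add[OF V(1)] unitary_scaleC[OF V(1)]
      by (intro L2.span_add L2.span_scale) (auto intro: L2.span_base)
  qed
  then have "closure (V ` L2.span B) \<subseteq> closure (L2.span (V ` B))"
    by (intro closure_mono) auto
  moreover have "V ` closure (L2.span B) \<subseteq> closure (V ` L2.span B)"
    by (rule image_closure_subset)
       (auto intro: continuous_on_subset[OF V(2)] closure_subset[THEN subsetD])
  ultimately have "V ` closure (L2.span B) \<subseteq> closure (L2.span (V ` B))"
    by (rule order.trans[rotated])
  then show "closure (L2.span (V ` B)) = UNIV"
    using B unitary_surj[OF V(1)] by (simp add: orthonormal_basis_def top.extremum_unique)
qed

section \<open>Integer powers of a unitary operator\<close>

lemma op_power_zero [simp]: "op_power A 0 f = f"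
  by (simp add: op_power_def)

lemma op_power_add:
  assumes A: "bij A"
  shows "op_power A (m + n) f = op_power A m (op_power A n f)"
proof -
  have [simp]: "A (inv A f) = f" for f
    using A by (simp add: bij_is_surj surj_f_inv_f)
  have suc: "op_power A (n + 1) f = A (op_power A n f)" for n f
  proof (cases "0 \<le> n")
    case True
    then show ?thesis
      by (simp add: op_power_def nat_add_distrib)
  next
    case False
    then have "nat (- n) = Suc (nat (- (n + 1)))"
      by simp
    with False show ?thesis
      by (auto simp: op_power_def)
  qed
  show ?thesis
  proof (induction m rule: int_induct[where k = 0])
    case (step1 i)
    then show ?case
      using suc[of "i + n" f] suc[of i "op_power A n f"] by (simp add: algebra_simps)
  next
    case (step2 i)
    then have "A (op_power A (i - 1 + n) f) = A (op_power A (i - 1) (op_power A n f))"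
      using suc[of "i - 1 + n" f] suc[of "i - 1" "op_power A n f"] by simp
    then show ?case
      using A by (metis bij_pointE)
  qed simp
qed

lemma unitary_op_power:
  assumes A: "unitary_operator A"
  shows "unitary_operator (op_power A n)"
proof -
  have "unitary_operator (B ^^ k)" if B: "unitary_operator B" for B k
  proof (induction k)
    case 0
    show ?case
      by (auto simp: unitary_between_def)
  next
    case (Suc k)
    then show ?case
      using unitary_comp[OF B Suc] by (simp add: o_def)
  qed
  then show ?thesis
    using A unitary_inv[OF A] by (auto simp: op_power_def)
qed

section \<open>Translations, dilations and the levels of a wavelet basis\<close>

lemma lebesgue_integral_translate:
  fixes f :: "real \<Rightarrow> complex"
  assumes [measurable]: "f \<in> borel_measurable lebesgue"
  shows "(\<integral>x. f (x + t) \<partial>lebesgue) = (\<integral>x. f x \<partial>lebesgue)"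
proof -
  have meas: "(\<lambda>x. t + 1 * x) \<in> lebesgue \<rightarrow>\<^sub>M lebesgue"
    using lebesgue_affine_measurable[where c = "\<lambda>x::real. 1"] by simp
  have "(\<integral>x. f x \<partial>lebesgue)
      = (\<integral>x. f x \<partial>density (distr lebesgue lebesgue (\<lambda>x. t + 1 * x)) (\<lambda>_. ennreal \<bar>1\<bar>))"
    using arg_cong[OF lebesgue_real_affine[of 1 t, OF one_neq_zero], of "\<lambda>M. integral\<^sup>L M f"] .
  also have "\<dots> = (\<integral>x. f x \<partial>distr lebesgue lebesgue (\<lambda>x. t + 1 * x))"
    by (simp add: density_1 del: integral_density)
  also have "\<dots> = (\<integral>x. f (t + 1 * x) \<partial>lebesgue)"
    by (rule integral_distr[OF meas]) measurable
  finally show ?thesis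
    by (simp add: add.commute)
qed

lemma lebesgue_nn_integral_affine:
  fixes f :: "real \<Rightarrow> ennreal"
  assumes [measurable]: "f \<in> borel_measurable lebesgue" and "c \<noteq> 0"
  shows "(\<integral>\<^sup>+x. f x \<partial>lebesgue) = ennreal \<bar>c\<bar> * (\<integral>\<^sup>+x. f (t + c * x) \<partial>lebesgue)"
proof -
  have meas: "(\<lambda>x. t + c * x) \<in> lebesgue \<rightarrow>\<^sub>M lebesgue"
    using lebesgue_affine_measurable[where c = "\<lambda>x::real. c"] \<open>c \<noteq> 0\<close> by simp
  have "(\<integral>\<^sup>+x. f x \<partial>lebesgue)
      = (\<integral>\<^sup>+x. f x \<partial>density (distr lebesgue lebesgue (\<lambda>x. t + c * x)) (\<lambda>_. ennreal \<bar>c\<bar>))"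
    using arg_cong[OF lebesgue_real_affine[OF \<open>c \<noteq> 0\<close>, of t], of "\<lambda>M. integral\<^sup>N M f"] .
  also have "\<dots> = (\<integral>\<^sup>+x. ennreal \<bar>c\<bar> * f x \<partial>distr lebesgue lebesgue (\<lambda>x. t + c * x))"
    by (rule nn_integral_density) (simp_all add: assms)
  also have "\<dots> = (\<integral>\<^sup>+x. ennreal \<bar>c\<bar> * f (t + c * x) \<partial>lebesgue)"
    by (rule nn_integral_distr[OF meas]) measurable
  also have "\<dots> = ennreal \<bar>c\<bar> * (\<integral>\<^sup>+x. f (t + c * x) \<partial>lebesgue)"
    using measurable_compose[OF meas assms(1)] by (rule nn_integral_cmult)
  finally show ?thesis .
qed

lemma affine_copy_add: "affine_copy j n (f + g) = affine_copy j n f + affine_copy j n g"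
proof (transfer, goal_cases)
  case (1 j n f g)
  then have "L2_rel (\<lambda>x. complex_of_real (2 powr (real_of_int j / 2)) * (f (real_of_int n + 2 powi j * x) + g (real_of_int n + 2 powi j * x)))
     (\<lambda>x. complex_of_real (2 powr (real_of_int j / 2)) * (f (real_of_int n + 2 powi j * x) + g (real_of_int n + 2 powi j * x)))"
    by (intro L2_rel_affine) (auto intro: square_integrable_add)
  then show ?case
    by (simp add: algebra_simps)
qed

lemma affine_copy_scaleC: "affine_copy j n (scaleC_L2 c f) = scaleC_L2 c (affine_copy j n f)"
proof (transfer, goal_cases)
  case (1 j n c f)
  then have "L2_rel (\<lambda>x. complex_of_real (2 powr (real_of_int j / 2)) * (c * f (real_of_int n + 2 powi j * x)))
     (\<lambda>x. complex_of_real (2 powr (real_of_int j / 2)) * (c * f (real_of_int n + 2 powi j * x)))"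
    by (intro L2_rel_affine) (auto intro: square_integrable_cmult)
  then show ?case
    by (simp add: algebra_simps)
qed

lemma unitary_translation: "unitary_operator (affine_copy 0 l)"
proof (rule unitary_operatorI)
  show "cinner_L2 (affine_copy 0 l f) (affine_copy 0 l g) = cinner_L2 f g" for f g
  proof (transfer, goal_cases)
    case (1 l f g)
    then show ?case
      using lebesgue_integral_translate[of "\<lambda>x. f x * cnj (g x)" "real_of_int l"]
      by (simp add: borel_measurable_integrable square_integrable_mult_cnj)
  qed
  show "\<exists>f. affine_copy 0 l f = g" for g
    by (rule exI[of _ "affine_copy 0 (- l) g"]) (simp add: affine_copy_translate affine_copy_zero)
qed (simp_all add: affine_copy_add affine_copy_scaleC)

text \<open>The commutation relation \<open>T\<^sup>m D\<^sup>j = D\<^sup>j T\<^sup>n\<close> with \<open>n = 2\<^sup>j m\<close>. For negative \<open>j\<close> the exponent \<open>n\<close> would not be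
  an integer in general; this asymmetry is why the levels \<open>j \<ge> 0\<close>, rather than the generators of the
  core space, are accessible.\<close>

lemma translate_affine_copy:
  assumes "0 \<le> j"
  shows "affine_copy 0 m (affine_copy j l f) = affine_copy j (l + 2 ^ nat j * m) f"
  using assms
proof (transfer, goal_cases)
  case (1 j m l f)
  then have "L2_rel (\<lambda>x. complex_of_real (2 powr (real_of_int j / 2)) * f (real_of_int (l + 2 ^ nat j * m) + 2 powi j * x))
     (\<lambda>x. complex_of_real (2 powr (real_of_int j / 2)) * f (real_of_int (l + 2 ^ nat j * m) + 2 powi j * x))"
    by (intro L2_rel_affine) auto
  then show ?case
    using 1 by (simp add: algebra_simps power_int_def)
qed

text \<open>The finite measure \<open>\<bar>f\<bar>\<^sup>2 dx\<close> is invariant under the expanding map \<open>x \<mapsto> a + c x\<close>, so all the balls of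
  radius \<open>c\<^sup>n\<close>, \<open>n \<in> \<int>\<close>, around the fixed point \<open>p\<close> of this map have the same measure. As \<open>n \<rightarrow> -\<infinity>\<close> they
  shrink to the null set \<open>{p}\<close>, as \<open>n \<rightarrow> \<infinity>\<close> they exhaust the line.\<close>

lemma AE_eq_0_if_affinely_invariant:
  fixes f :: "real \<Rightarrow> complex"
  assumes f: "square_integrable f" and c: "c > 1" and s: "(cmod s)\<^sup>2 = c"
    and inv: "AE x in lebesgue. s * f (a + c * x) = f x"
  shows "AE x in lebesgue. f x = 0"
proof -
  note [measurable] = square_integrable_measurable[OF f]
  define M where "M = density lebesgue (\<lambda>x. ennreal ((cmod (f x))\<^sup>2))"
  define p where "p = a / (1 - c)"
  have p: "a + c * p = p"
    using c by (simp add: p_def field_simps)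
  have sets_M [simp]: "sets M = sets lebesgue"
    by (simp add: M_def)
  have emeasure_M: "emeasure M A = (\<integral>\<^sup>+x. ennreal ((cmod (f x))\<^sup>2) * indicator A x \<partial>lebesgue)"
    if "A \<in> sets lebesgue" for A
    unfolding M_def by (rule emeasure_density) (use that in auto)
  have ball_dilate: "emeasure M (ball p (c * r)) = emeasure M (ball p r)" for r
  proof -
    have ind: "indicator (ball p (c * r)) (a + c * x) = (indicator (ball p r) x :: ennreal)" for x
    proof -
      have "dist p (a + c * x) = c * dist p x"
        using c by (subst p[symmetric]) (simp add: dist_real_def abs_mult flip: right_diff_distrib)
      then show ?thesis
        using c by (simp add: indicator_def)
    qed
    have meas: "(\<lambda>x. ennreal ((cmod (g x))\<^sup>2) * indicator (ball p t) x) \<in> borel_measurable lebesgue"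
      if "square_integrable g" for g t
    proof -
      note [measurable] = square_integrable_measurable[OF that]
      have [measurable]: "ball p t \<in> sets lebesgue"
        by simp
      show ?thesis
        by measurable
    qed
    from meas[OF f] have "emeasure M (ball p (c * r))
        = ennreal \<bar>c\<bar> * (\<integral>\<^sup>+x. ennreal ((cmod (f (a + c * x)))\<^sup>2) * indicator (ball p (c * r)) (a + c * x) \<partial>lebesgue)"
      using c lebesgue_nn_integral_affine[of "\<lambda>x. ennreal ((cmod (f x))\<^sup>2) * indicator (ball p (c * r)) x" c a]
      by (simp add: emeasure_M)
    also have "\<dots> = (\<integral>\<^sup>+x. ennreal \<bar>c\<bar> * (ennreal ((cmod (f (a + c * x)))\<^sup>2) * indicator (ball p r) x) \<partial>lebesgue)"
      unfolding ind using meas[OF square_integrable_affine[OF _ f, of c a]] c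
      by (intro nn_integral_cmult[symmetric]) auto
    also have "\<dots> = (\<integral>\<^sup>+x. ennreal ((cmod (f x))\<^sup>2) * indicator (ball p r) x \<partial>lebesgue)"
    proof (rule nn_integral_cong_AE, use inv in eventually_elim)
      case (elim x)
      have "(cmod (f x))\<^sup>2 = c * (cmod (f (a + c * x)))\<^sup>2"
        by (subst elim[symmetric]) (simp add: norm_mult power_mult_distrib s)
      then show ?case
        using c by (simp add: ennreal_mult mult.assoc)
    qed
    also have "\<dots> = emeasure M (ball p r)"
      by (subst emeasure_M) auto
    finally show ?thesis .
  qed
  have ball_dilate_pow: "emeasure M (ball p (c ^ n * r)) = emeasure M (ball p r)" for n r
    by (induction n) (simp_all add: ball_dilate mult.assoc)
  have "emeasure M (ball p 1) = 0"
  proof -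
    let ?A = "\<lambda>n. ball p (1 / c ^ n)"
    have "emeasure M UNIV \<noteq> \<infinity>"
      using f by (subst emeasure_M) (auto simp: square_integrable_def integrable_iff_bounded)
    then have fin: "emeasure M A \<noteq> \<infinity>" if "A \<in> sets lebesgue" for A
      using emeasure_mono[of A UNIV M] that by (auto simp: top_unique)
    have "(\<lambda>n. emeasure M (?A n)) \<longlonglongrightarrow> emeasure M (\<Inter>n. ?A n)"
      using c by (intro Lim_emeasure_decseq fin)
        (auto simp: decseq_def intro!: subset_ball divide_left_mono power_increasing)
    moreover have "emeasure M (?A n) = emeasure M (ball p 1)" for n
      using ball_dilate_pow[of n "1 / c ^ n"] c by simp
    moreover have "(\<Inter>n. ?A n) = {p}"
    proof -
      have "x = p" if x: "\<And>n. dist p x < 1 / c ^ n" for x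
      proof -
        have "(\<lambda>n. (1 / c) ^ n) \<longlonglongrightarrow> 0"
          using c by (intro LIMSEQ_power_zero) auto
        then have "dist p x \<le> 0"
          by (rule LIMSEQ_le_const) (use x in \<open>auto simp: power_divide intro: less_imp_le\<close>)
        then show ?thesis
          by simp
      qed
      then show ?thesis
        using c by auto
    qed
    moreover have "emeasure M {p} = 0"
    proof -
      have "AE x in lebesgue. ennreal ((cmod (f x))\<^sup>2) * indicator {p} x = 0"
        by (rule AE_mp[OF AE_not_in[of "{p}"]]) auto
      then show ?thesis
        by (subst emeasure_M) (auto simp: nn_integral_0_iff_AE)
    qed
    ultimately show ?thesis
      by (simp add: LIMSEQ_const_iff)
  qed
  then have "emeasure M (\<Union>n. ball p (c ^ n)) = 0"
    using ball_dilate_pow[of _ 1] by (intro emeasure_UN_eq_0) auto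
  moreover have "(\<Union>n. ball p (c ^ n)) = UNIV"
    using real_arch_pow[OF c] by auto
  ultimately have "(\<integral>\<^sup>+x. ennreal ((cmod (f x))\<^sup>2) \<partial>lebesgue) = 0"
    using emeasure_M[of UNIV] by simp
  then show ?thesis
    by (subst (asm) nn_integral_0_iff_AE) auto
qed

lemma affine_copy_fixed_eq_0:
  assumes "0 < k" and "affine_copy k a f = f"
  shows "f = 0"
  using assms
proof (transfer, goal_cases)
  case (1 k a f)
  have "(cmod (complex_of_real (2 powr (real_of_int k / 2))))\<^sup>2 = 2 powi k"
    by (simp add: power2_eq_square powr_real_of_int' flip: powr_add)
  moreover have "(1 :: real) < 2 powi k"
    using 1(1) by (intro one_less_power_int) auto
  ultimately have "AE x in lebesgue. f x = 0"
    using 1 AE_eq_0_if_affinely_invariant[of f "2 powi k" "complex_of_real (2 powr (real_of_int k / 2))" "real_of_int a"]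
    by (auto simp: L2_rel_def add.commute)
  with 1 show ?case
    by (simp add: L2_rel_def square_integrable_zero)
qed

text \<open>An orthonormal basis is a set, so for this to follow, two elements from different levels must
  not coincide as vectors. If they did, \<open>\<psi>\<close> would be fixed by a proper dilation about some point,
  which is impossible for a nonzero square-integrable function.\<close>

lemma wavelet_levels_orthogonal:
  assumes \<psi>: "wavelet \<psi>" and less: "j < j'"
  shows "cinner_L2 (affine_copy j l \<psi>) (affine_copy j' l' \<psi>) = 0"
proof -
  have "affine_copy j l \<psi> \<noteq> affine_copy j' l' \<psi>"
  proof
    let ?k = "j' - j"
    assume "affine_copy j l \<psi> = affine_copy j' l' \<psi>"
    then have "affine_copy 0 (- l) (affine_copy (- j) 0 (affine_copy j l \<psi>))
        = affine_copy 0 (- l) (affine_copy (- j) 0 (affine_copy j' l' \<psi>))"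
      by simp
    then have "\<psi> = affine_copy ?k (l' + 2 ^ nat ?k * - l) \<psi>"
      using less by (simp add: affine_copy_dilate affine_copy_translate affine_copy_zero translate_affine_copy)
    then have "\<psi> = 0"
      using less affine_copy_fixed_eq_0[of ?k] by (metis diff_gt_0_iff_gt)
    moreover have "norm (affine_copy 0 0 \<psi>) = 1"
      using \<psi> unfolding wavelet_def orthonormal_basis_def by blast
    ultimately show False
      by (simp add: affine_copy_zero)
  qed
  then show ?thesis
    using \<psi> unfolding wavelet_def orthonormal_basis_def pairwise_def by blast
qed

section \<open>Core spaces and core equivalence\<close>

text \<open>The point of this description is that the levels \<open>j \<ge> 0\<close> are invariant under integer
  translations, while the generators of the core space are not. It holds because a vector orthogonal to
  the levels \<open>j \<ge> 0\<close> differs from its projection to the core space by a vector orthogonal to the whole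
  basis.\<close>

lemma core_space_eq_ortho:
  assumes \<psi>: "wavelet \<psi>"
  shows "core_space \<psi> = ortho {affine_copy j l \<psi> | j l. 0 \<le> j}"
proof -
  let ?neg = "{affine_copy j l \<psi> | j l. j < 0}" and ?pos = "{affine_copy j l \<psi> | j l. 0 \<le> j}"
  have core: "core_space \<psi> = closure (L2.span ?neg)"
    by (simp add: core_space_def affine_copy_eq)
  have "?neg \<subseteq> ortho ?pos"
    using wavelet_levels_orthogonal[OF \<psi>] by (fastforce intro: orthoI)
  then have core_sub: "core_space \<psi> \<subseteq> ortho ?pos"
    unfolding core by (intro closure_span_subset subspace_ortho closed_ortho)
  have "f \<in> core_space \<psi>" if f: "f \<in> ortho ?pos" for f
  proof -
    have "L2.subspace (core_space \<psi>)" "closed (core_space \<psi>)"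
      unfolding core by (simp_all add: subspace_closure)
    then obtain a b where ab: "a \<in> core_space \<psi>" "b \<in> ortho (core_space \<psi>)" "f = a + b"
      by (rule exists_orthogonal_decomposition)
    have neg: "b \<in> ortho ?neg"
      using ab(2) by (simp add: core ortho_closure_span)
    have pos: "b \<in> ortho ?pos"
      using L2.subspace_diff[OF subspace_ortho f, of a] core_sub ab by auto
    have "b \<in> ortho {affine_copy j l \<psi> | j l. True}"
    proof (rule orthoI)
      fix g assume "g \<in> {affine_copy j l \<psi> | j l. True}"
      then have "g \<in> ?neg \<or> g \<in> ?pos"
        by (auto simp: not_less[symmetric])
      then show "cinner_L2 b g = 0"
        using orthoD[OF neg] orthoD[OF pos] by blast
    qed
    then have "b \<in> ortho (closure (L2.span {affine_copy j l \<psi> | j l. True}))"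
      by (simp add: ortho_closure_span)
    then have "b = 0"
      using \<psi> by (simp add: wavelet_def orthonormal_basis_def ortho_UNIV)
    with ab show ?thesis
      by simp
  qed
  with core_sub show ?thesis
    by blast
qed

lemma core_equivalentI:
  assumes W: "unitary_operator W"
    and comm: "\<And>l f. W (affine_copy 0 l f) = affine_copy 0 l (W f)"
    and core: "W ` core_space \<psi> = core_space \<phi>"
  shows "core_equivalent \<psi> \<phi>"
proof -
  have tr: "op_power translation l = affine_copy 0 l" for l
    using affine_copy_eq[of 0 l] by (simp add: fun_eq_iff)
  have "unitary_between (core_space \<psi>) (core_space \<phi>) W"
    using W core by (auto simp: unitary_between_def)
  moreover have "W (core_representation \<psi> l f) = core_representation \<phi> l (W f)"
    if "f \<in> core_space \<psi>" for l f
    using that core comm by (auto simp: core_representation_def tr)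
  ultimately show ?thesis
    unfolding core_equivalent_def unitarily_equivalent_def by blast
qed

theorem theorem2:
  fixes \<psi> :: L2 and U :: "L2 \<Rightarrow> L2"
  assumes "wavelet \<psi>"
    and "unitary_operator U"
    and "\<forall>n::int. op_power U n \<in> local_commutant dilation translation \<psi>"
  shows "(\<forall>n::int. wavelet (op_power U n \<psi>)) \<and>
    (\<forall>m n :: int. core_equivalent (op_power U m \<psi>) (op_power U n \<psi>))"
proof (intro conjI allI)
  note U = unitary_op_power[OF assms(2)]
  have U_add: "op_power U m (op_power U n f) = op_power U (m + n) f" for m n f
    by (rule op_power_add[OF unitary_bij[OF assms(2)], symmetric])
  have U_copy: "op_power U n (affine_copy j l \<psi>) = affine_copy j l (op_power U n \<psi>)" for n j l
    using assms(3) by (simp add: local_commutant_def affine_copy_eq)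
  show wavelet: "wavelet (op_power U n \<psi>)" for n
  proof -
    have "continuous_on UNIV (op_power U n)"
      using assms(3) by (auto simp: local_commutant_def bounded_operator_def
          intro: linear_continuous_on)
    then have "orthonormal_basis (op_power U n ` {affine_copy j l \<psi> | j l. True})"
      using assms(1) unfolding wavelet_def by (intro orthonormal_basis_unitary_image U)
    also have "op_power U n ` {affine_copy j l \<psi> | j l. True}
        = {affine_copy j l (op_power U n \<psi>) | j l. True}"
      by (auto simp: U_copy[symmetric])
    finally show ?thesis
      by (simp add: wavelet_def)
  qed

  \<comment> \<open>The closed span of \<open>S\<close> is the smallest closed subspace that contains the levels \<open>j \<ge> 0\<close> of
    \<open>\<psi>\<close> and is invariant under all powers of \<open>U\<close>.\<close>
  define S where "S = {affine_copy j l (op_power U n \<psi>) | j l n. 0 \<le> j}"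
  have S_mem: "affine_copy j l (op_power U n \<psi>) \<in> S" if "0 \<le> j" for j l n
    using that unfolding S_def by blast
  have S_cases: thesis
    if "s \<in> S" "\<And>j l n. 0 \<le> j \<Longrightarrow> s = affine_copy j l (op_power U n \<psi>) \<Longrightarrow> thesis" for s thesis
    using that unfolding S_def by blast
  have U_gen: "op_power U k (affine_copy j l (op_power U n \<psi>)) = affine_copy j l (op_power U (k + n) \<psi>)"
    for k j l n
    by (simp add: U_copy[symmetric] U_add)
  have U_S: "op_power U k ` S = S" for k
  proof -
    have sub: "op_power U k ` S \<subseteq> S" for k
      by (auto elim!: S_cases simp: U_gen intro!: S_mem)
    have "s \<in> op_power U k ` S" if "s \<in> S" for s
    proof (rule image_eqI)
      show "s = op_power U k (op_power U (- k) s)"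
        by (simp add: U_add)
      show "op_power U (- k) s \<in> S"
        using sub[of "- k"] that by blast
    qed
    with sub[of k] show ?thesis
      by blast
  qed
  have T_S: "affine_copy 0 l ` S = S" for l
  proof -
    have sub: "affine_copy 0 l ` S \<subseteq> S" for l
      by (auto elim!: S_cases simp: translate_affine_copy intro!: S_mem)
    have "s \<in> affine_copy 0 l ` S" if "s \<in> S" for s
    proof (rule image_eqI)
      show "s = affine_copy 0 l (affine_copy 0 (- l) s)"
        by (simp add: affine_copy_translate affine_copy_zero)
      show "affine_copy 0 (- l) s \<in> S"
        using sub[of "- l"] that by blast
    qed
    with sub[of l] show ?thesis
      by blast
  qed

  fix m n :: int
  define k where "k = n - m"
  obtain W where W: "unitary_operator W"
    and W_split: "\<And>a b. a \<in> ortho S \<Longrightarrow> b \<in> ortho (ortho S) \<Longrightarrow> W (a + b) = a + op_power U k b"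
    using unitary_glue_identity[OF U U_S] by metis
  show "core_equivalent (op_power U m \<psi>) (op_power U n \<psi>)"
  proof (rule core_equivalentI[OF W])
    fix l f
    \<comment> \<open>Here all the powers of \<open>U\<close> are needed: a generator \<open>s\<close> is itself of the form \<open>U\<^sup>n D\<^sup>j T\<^sup>i \<psi>\<close>.\<close>
    have "op_power U k (affine_copy 0 l s) = affine_copy 0 l (op_power U k s)" if "s \<in> S" for s
      using that by (auto elim!: S_cases simp: translate_affine_copy U_gen)
    then show "W (affine_copy 0 l f) = affine_copy 0 l (W f)"
      using W_split by (rule unitary_glue_identity_commutes[OF U unitary_translation T_S])
  next
    let ?pos = "\<lambda>n. {affine_copy j l (op_power U n \<psi>) | j l. 0 \<le> j}"
    have pos_image: "?pos n = (\<lambda>(j, l). affine_copy j l (op_power U n \<psi>)) ` {(j, l). 0 \<le> j}" for n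
      by auto
    have W_S: "W s = op_power U k s" if "s \<in> S" for s
      using W_split[of 0 s] subset_ortho_ortho that L2.subspace_0[OF subspace_ortho] by auto
    have "W (affine_copy j l (op_power U m \<psi>)) = affine_copy j l (op_power U n \<psi>)" if "0 \<le> j" for j l
      using W_S[of "affine_copy j l (op_power U m \<psi>)"] that
      by (simp add: S_mem U_gen k_def)
    then have "W ` ?pos m = (\<lambda>(j, l). affine_copy j l (op_power U n \<psi>)) ` {(j, l). 0 \<le> j}"
      unfolding pos_image by (simp add: image_image case_prod_unfold)
    then have "W ` ?pos m = ?pos n"
      unfolding pos_image .
    then show "W ` core_space (op_power U m \<psi>) = core_space (op_power U n \<psi>)"
      by (simp add: core_space_eq_ortho wavelet unitary_image_ortho[OF W])
  qed
qed

end
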